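(* For any integer $n\ge 1$ and any formal Fourier series $f$ on $\mathbb{T}$, $$c_n(f)\ge\sup_{q\ge 2}\|\Gamma_q^{(n)}[f]\|,$$ where the supremum is over integers $q\ge 2$ and $$c_n(f):=\inf\big\{\|g\|_\infty : g\in L^\infty(\mathbb{T})\text{ and }\widehat g(k)=\widehat f(k)\text{ for all integers }k\text{ with }-n\le k\le n\big\}.$$
   Context: For an integer $q\ge2$, $T_q$ denotes the (vertex set of the) infinite rooted $q$-homogeneous tree: there is a root $o$, and each vertex has exactly $q$ children. $d$ is the graph distance and $|\sigma| := d(o,\sigma)$. Two vertices are comparable if they lie on a common geodesic ray starting at the root; $\mathcal{C}\subset T_q\times T_q$ is the set of comparable pairs, with indicator $\mathbf{1}_{\mathcal{C}}$. $\mathbb{B}_n(T_q)=\{\sigma\in T_q:|\sigma|\le n\}$. $\mathbb{T}=\mathbb{R}/2\pi\mathbb{Z}$. A formal Fourier series $f\sim\sum_{n\in\mathbb{Z}}\widehat f(n)e^{in\theta}$ is an arbitrary sequence $(\widehat f(n))_{n\in\mathbb{Z}}$ of complex numbers; for $g\in L^\infty(\mathbb{T})$, $\widehat g(n)=\int_{\mathbb{T}} g(e^{i\theta})e^{-in\theta}\frac{d\theta}{2\pi}$. $\Gamma_q[f](\sigma_1,\sigma_2) := q^{-d(\sigma_1,\sigma_2)/2}\,\widehat f(|\sigma_1|-|\sigma_2|)\,\mathbf{1}_{\mathcal{C}}(\sigma_1,\sigma_2)$, and $\Gamma_q^{(n)}[f]$ is the restriction of $\Gamma_q[f]$ to $\mathbb{B}_n(T_q)\times\mathbb{B}_n(T_q)$,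 a finite matrix acting on $\mathbb{C}^{\mathbb{B}_n(T_q)}$, with operator norm induced by the Euclidean norm. *)

theory Defs
  imports "HOL-Probability.Probability"
begin

text \<open>A vertex of \<open>T\<^sub>q\<close> is the word of child labels in \<open>{0..<q}\<close> read along the path
  from the root \<open>[]\<close>; the children of \<open>u\<close> are the words \<open>u @ [i]\<close> with \<open>i < q\<close>.\<close>

definition tree_verts :: "nat \<Rightarrow> nat list set" where
  "tree_verts q = lists {..<q}"

definition tree_edges :: "nat \<Rightarrow> (nat list \<times> nat list) set" where
  "tree_edges q = {(u, v). u \<in> tree_verts q \<and> v \<in> tree_verts q \<and>
     (\<exists>i. v = u @ [i] \<or> u = v @ [i])}"

definition tree_dist :: "nat \<Rightarrow> nat list \<Rightarrow> nat list \<Rightarrow> nat" where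
  "tree_dist q u v = (LEAST k. (u, v) \<in> tree_edges q ^^ k)"

definition tree_level :: "nat \<Rightarrow> nat list \<Rightarrow> nat" where
  "tree_level q u = tree_dist q [] u"

definition root_geodesic_ray :: "nat \<Rightarrow> (nat \<Rightarrow> nat list) \<Rightarrow> bool" where
  "root_geodesic_ray q \<gamma> \<longleftrightarrow> \<gamma> 0 = [] \<and> range \<gamma> \<subseteq> tree_verts q \<and>
     (\<forall>i j. int (tree_dist q (\<gamma> i) (\<gamma> j)) = \<bar>int i - int j\<bar>)"

definition comparable_pairs :: "nat \<Rightarrow> (nat list \<times> nat list) set" where
  "comparable_pairs q = {(u, v). \<exists>\<gamma>. root_geodesic_ray q \<gamma> \<and> u \<in> range \<gamma> \<and> v \<in> range \<gamma>}"

definition tree_ball :: "nat \<Rightarrow> nat \<Rightarrow> nat list set" where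
  "tree_ball q n = {u \<in> tree_verts q. tree_level q u \<le> n}"

definition Gamma_kernel :: "nat \<Rightarrow> (int \<Rightarrow> complex) \<Rightarrow> nat list \<Rightarrow> nat list \<Rightarrow> complex" where
  "Gamma_kernel q f u v =
     complex_of_real (real q powr (- real (tree_dist q u v) / 2)) *
     f (int (tree_level q u) - int (tree_level q v)) * indicator (comparable_pairs q) (u, v)"

text \<open>Operator norm of the matrix \<open>(A u v)\<close>, \<open>u, v \<in> B\<close>, on \<open>\<complex>\<^sup>B\<close> with the Euclidean norm.
  It is meant for finite \<open>B\<close>; only the values of \<open>A\<close> on \<open>B \<times> B\<close> and of \<open>x\<close> on \<open>B\<close> matter.\<close>

definition matrix_onorm :: "'a set \<Rightarrow> ('a \<Rightarrow> 'a \<Rightarrow> complex) \<Rightarrow> real" where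
  "matrix_onorm B A =
     (SUP x \<in> {x. L2_set (\<lambda>v. cmod (x v)) B \<le> 1}.
        L2_set (\<lambda>u. cmod (\<Sum>v\<in>B. A u v * x v)) B)"

definition Gamma_norm :: "nat \<Rightarrow> nat \<Rightarrow> (int \<Rightarrow> complex) \<Rightarrow> real" where
  "Gamma_norm q n f = matrix_onorm (tree_ball q n) (Gamma_kernel q f)"

text \<open>The measure \<open>d\<theta>/2\<pi>\<close> on a period, and its image on the unit circle.\<close>

definition angle_measure :: "real measure" where
  "angle_measure = uniform_measure lborel {0..<2 * pi}"

definition circle_measure :: "complex measure" where
  "circle_measure = distr angle_measure (restrict_space borel (sphere 0 1)) cis"

definition Linf_norm :: "(complex \<Rightarrow> complex) \<Rightarrow> ereal" where
  "Linf_norm g = esssup circle_measure (\<lambda>z. ereal (cmod (g z)))"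

text \<open>Representatives of the elements of \<open>L\<^sup>\<infinity>\<close>; values off the unit circle are irrelevant.\<close>

definition Linf_circle :: "(complex \<Rightarrow> complex) set" where
  "Linf_circle = {g \<in> borel_measurable circle_measure. Linf_norm g < \<infinity>}"

definition fourier_coeff :: "(complex \<Rightarrow> complex) \<Rightarrow> int \<Rightarrow> complex" where
  "fourier_coeff g k = (LINT t|angle_measure. g (cis t) * cis (- (real_of_int k * t)))"

text \<open>A formal Fourier series is its coefficient sequence \<open>f :: int \<Rightarrow> complex\<close>.
  Infima and suprema of norms are taken in \<open>ereal\<close>, where they always exist.\<close>

definition c_const :: "nat \<Rightarrow> (int \<Rightarrow> complex) \<Rightarrow> ereal" where
  "c_const n f =
     (INF g \<in> {g \<in> Linf_circle. \<forall>k. - int n \<le> k \<and> k \<le> int n \<longrightarrow> fourier_coeff g k = f k}.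
        Linf_norm g)"

end

theory Submission
  imports Defs "HOL-Library.Sublist"
begin

text \<open>
  Let \<open>g\<close> be bounded on the circle with the prescribed Fourier coefficients for \<open>\<bar>k\<bar> \<le> n\<close>.
  Level differences in the ball of radius \<open>n\<close> stay in this range, so \<open>\<Gamma>\<close> is built from the
  coefficients of \<open>g\<close> alone.

  The idea is that \<open>\<Gamma>\<close> is a compression of a direct sum of classical Toeplitz matrices. Choose
  uniformly one of the \<open>q ^ n\<close> geodesics of length \<open>n\<close> starting at the root. It passes through
  both \<open>u\<close> and \<open>v\<close> with probability \<open>q ^ (- max \<bar>u\<bar> \<bar>v\<bar>)\<close> if they are comparable and \<open>0\<close>
  otherwise, and for comparable vertices this is
  \<open>q ^ (- \<bar>u\<bar>/2) \<cdot> q ^ (- \<bar>v\<bar>/2) \<cdot> q ^ (- d(u,v)/2)\<close>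
  (\<open>card_leaves_above_pair\<close>). Hence the sesquilinear form of \<open>\<Gamma>\<close> is the expectation of the Toeplitz
  form \<open>\<Sum>\<^sub>j \<Sum>\<^sub>k cnj (a\<^sub>j) f(j - k) b\<^sub>k\<close>, where \<open>a\<close> and \<open>b\<close> are the restrictions of \<open>y\<close> and \<open>x\<close> to
  the random geodesic, multiplied by \<open>q ^ (j/2)\<close> at level \<open>j\<close> (\<open>Gamma_form_average\<close>). The same
  count shows that \<open>\<parallel>a\<parallel>\<^sup>2\<close> and \<open>\<parallel>b\<parallel>\<^sup>2\<close> have expectations \<open>\<parallel>y\<parallel>\<^sup>2\<close> and \<open>\<parallel>x\<parallel>\<^sup>2\<close>
  (\<open>leaf_rows_isometry\<close>).

  On a single geodesic, the Toeplitz form is the integral of \<open>g\<close> against a product of two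
  trigonometric polynomials, so Parseval bounds it by \<open>\<parallel>g\<parallel>\<^sub>\<infinity> (\<parallel>a\<parallel>\<^sup>2 + \<parallel>b\<parallel>\<^sup>2) / 2\<close>
  (\<open>toeplitz_form_bound\<close>). Taking expectations gives the same bound for the form of \<open>\<Gamma>\<close>, which
  is equivalent to \<open>\<parallel>\<Gamma>\<parallel> \<le> \<parallel>g\<parallel>\<^sub>\<infinity>\<close> (\<open>matrix_onorm_le\<close>).
\<close>

section \<open>Distances and comparability in the tree\<close>

lemma tree_path_length_bound:
  assumes "(u, v) \<in> tree_edges q ^^ k"
  shows "\<bar>int (length u) - int (length v)\<bar> \<le> int k"
  using assms
proof (induction k arbitrary: v)
  case 0
  then show ?case by simp
next
  case (Suc k)
  then obtain w where w: "(u, w) \<in> tree_edges q ^^ k" "(w, v) \<in> tree_edges q"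
    by auto
  from w(2) have "\<bar>int (length w) - int (length v)\<bar> \<le> 1"
    by (auto simp: tree_edges_def)
  with Suc.IH[OF w(1)] show ?case by simp
qed

lemma tree_path_sym:
  assumes "(u, v) \<in> tree_edges q ^^ k"
  shows "(v, u) \<in> tree_edges q ^^ k"
  using assms
proof (induction k arbitrary: v)
  case 0
  then show ?case by simp
next
  case (Suc k)
  then obtain w where w: "(u, w) \<in> tree_edges q ^^ k" "(w, v) \<in> tree_edges q"
    by auto
  from w(2) have "(v, w) \<in> tree_edges q"
    by (auto simp: tree_edges_def)
  with Suc.IH[OF w(1)] show ?case by (meson relpow_Suc_I2)
qed

lemma tree_path_append:
  assumes "u @ s \<in> tree_verts q"
  shows "(u, u @ s) \<in> tree_edges q ^^ length s"
  using assms
proof (induction s rule: rev_induct)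
  case Nil
  then show ?case by simp
next
  case (snoc a s)
  have "u @ s \<in> tree_verts q" "u @ s @ [a] \<in> tree_verts q"
    using snoc.prems by (auto simp: tree_verts_def)
  then have "(u @ s, u @ s @ [a]) \<in> tree_edges q"
    by (auto simp: tree_edges_def)
  with snoc show ?case by (auto simp: tree_verts_def)
qed

lemma tree_dist_le: "(u, v) \<in> tree_edges q ^^ k \<Longrightarrow> tree_dist q u v \<le> k"
  unfolding tree_dist_def by (rule Least_le)

text \<open>Going through the root joins any two vertices, so the \<open>LEAST\<close> in the definition of
  \<open>tree_dist\<close> is attained.\<close>

lemma tree_dist_path:
  assumes "u \<in> tree_verts q" "v \<in> tree_verts q"
  shows "(u, v) \<in> tree_edges q ^^ tree_dist q u v"
proof -
  have "(u, []) \<in> tree_edges q ^^ length u" "([], v) \<in> tree_edges q ^^ length v"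
    using tree_path_append[of "[]"] assms tree_path_sym by auto
  then have "(u, v) \<in> tree_edges q ^^ (length u + length v)"
    by (auto simp: relpow_add)
  then show ?thesis
    unfolding tree_dist_def by (rule LeastI)
qed

lemma tree_dist_sym: "tree_dist q u v = tree_dist q v u"
proof -
  have "(u, v) \<in> tree_edges q ^^ k \<longleftrightarrow> (v, u) \<in> tree_edges q ^^ k" for k
    using tree_path_sym by blast
  then show ?thesis by (simp add: tree_dist_def)
qed

text \<open>Each edge changes the length of the word by one, so no path is shorter than the difference
  of lengths; appending the missing labels one at a time attains it.\<close>

lemma tree_dist_prefix:
  assumes "prefix u v" "v \<in> tree_verts q"
  shows "tree_dist q u v = length v - length u"
proof -
  obtain s where s: "v = u @ s" using assms(1) by (auto simp: prefix_def)
  have "u \<in> tree_verts q" using assms(2) s by (auto simp: tree_verts_def)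
  from tree_path_length_bound[OF tree_dist_path[OF this assms(2)]]
  have "length s \<le> tree_dist q u v" using s by simp
  moreover have "tree_dist q u v \<le> length s"
    using tree_dist_le tree_path_append assms(2) s by blast
  ultimately show ?thesis using s by simp
qed

lemma tree_level_eq_length: "u \<in> tree_verts q \<Longrightarrow> tree_level q u = length u"
  using tree_dist_prefix[of "[]" u q] by (simp add: tree_level_def)

text \<open>The distance to the root forces the lengths, and consecutive vertices are adjacent; of the
  two directions of an edge, only the one towards a child increases the length.\<close>

lemma root_geodesic_ray_step:
  assumes "root_geodesic_ray q \<gamma>"
  shows "length (\<gamma> i) = i" and "\<exists>a. \<gamma> (Suc i) = \<gamma> i @ [a]"
proof -
  have V: "\<gamma> j \<in> tree_verts q" and D: "int (tree_dist q (\<gamma> j) (\<gamma> k)) = \<bar>int j - int k\<bar>"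
    and "\<gamma> 0 = []" for j k
    using assms by (auto simp: root_geodesic_ray_def)
  have L: "length (\<gamma> j) = j" for j
    using D[of 0 j] tree_level_eq_length[OF V[of j]] \<open>\<gamma> 0 = []\<close> by (simp add: tree_level_def)
  show "length (\<gamma> i) = i" by (rule L)
  have "tree_dist q (\<gamma> i) (\<gamma> (Suc i)) = 1" using D[of i "Suc i"] by simp
  with tree_dist_path[OF V[of i] V[of "Suc i"]]
  have "(\<gamma> i, \<gamma> (Suc i)) \<in> tree_edges q" by simp
  then obtain a where "\<gamma> (Suc i) = \<gamma> i @ [a] \<or> \<gamma> i = \<gamma> (Suc i) @ [a]"
    by (auto simp: tree_edges_def)
  moreover have "\<gamma> i \<noteq> \<gamma> (Suc i) @ [a]"
  proof
    assume eq: "\<gamma> i = \<gamma> (Suc i) @ [a]"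
    have "length (\<gamma> i) = Suc (length (\<gamma> (Suc i)))" by (subst eq) simp
    then show False by (simp add: L)
  qed
  ultimately show "\<exists>a. \<gamma> (Suc i) = \<gamma> i @ [a]" by blast
qed

lemma root_geodesic_ray_prefix:
  assumes "root_geodesic_ray q \<gamma>" "i \<le> j"
  shows "prefix (\<gamma> i) (\<gamma> j)"
  using assms(2)
proof (induction j rule: dec_induct)
  case base
  then show ?case by simp
next
  case (step j)
  then show ?case
    using root_geodesic_ray_step(2)[OF assms(1), of j] by (metis prefix_prefix)
qed

text \<open>The ray descends to \<open>v\<close> and continues below it along children labelled \<open>0\<close>, which
  exist as soon as \<open>q \<ge> 1\<close>.\<close>

lemma prefix_comparable:
  assumes "q \<ge> 1" "v \<in> tree_verts q" "prefix u v"
  shows "(u, v) \<in> comparable_pairs q"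
proof -
  define \<gamma> where "\<gamma> i = take i v @ replicate (i - length v) 0" for i
  have L: "length (\<gamma> i) = i" for i by (simp add: \<gamma>_def)
  have V: "\<gamma> i \<in> tree_verts q" for i
    using assms(1,2) by (auto simp: \<gamma>_def tree_verts_def dest: in_set_takeD)
  have P: "prefix (\<gamma> i) (\<gamma> j)" if "i \<le> j" for i j
  proof -
    have "\<gamma> i = take i (\<gamma> j)"
      using that by (auto simp: \<gamma>_def min_def)
    then show ?thesis by (metis take_is_prefix)
  qed
  have D: "int (tree_dist q (\<gamma> i) (\<gamma> j)) = \<bar>int i - int j\<bar>" for i j
  proof (cases "i \<le> j")
    case True
    then show ?thesis using tree_dist_prefix[OF P V] by (simp add: L)
  next
    case False
    then show ?thesis
      using tree_dist_prefix[OF P V, of j i] tree_dist_sym[of q "\<gamma> i" "\<gamma> j"] by (simp add: L)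
  qed
  have "root_geodesic_ray q \<gamma>"
    using D V by (auto simp: root_geodesic_ray_def \<gamma>_def)
  moreover have "\<gamma> (length v) = v" by (simp add: \<gamma>_def)
  moreover have "\<gamma> (length u) = u"
    using assms(3) by (auto simp: \<gamma>_def prefix_def)
  ultimately have "root_geodesic_ray q \<gamma> \<and> u \<in> range \<gamma> \<and> v \<in> range \<gamma>"
    by (metis rangeI)
  then show ?thesis unfolding comparable_pairs_def by blast
qed

lemma comparable_pairs_iff_prefix:
  assumes "q \<ge> 1" "u \<in> tree_verts q" "v \<in> tree_verts q"
  shows "(u, v) \<in> comparable_pairs q \<longleftrightarrow> prefix u v \<or> prefix v u"
proof
  assume "(u, v) \<in> comparable_pairs q"
  then show "prefix u v \<or> prefix v u"
    unfolding comparable_pairs_def using root_geodesic_ray_prefix nat_le_linear by blast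
next
  have "(v, u) \<in> comparable_pairs q \<Longrightarrow> (u, v) \<in> comparable_pairs q"
    by (auto simp: comparable_pairs_def)
  moreover assume "prefix u v \<or> prefix v u"
  ultimately show "(u, v) \<in> comparable_pairs q"
    using prefix_comparable assms by blast
qed

lemma tree_ball_eq: "tree_ball q n = {u. set u \<subseteq> {..<q} \<and> length u \<le> n}"
  unfolding tree_ball_def
  by (rule Collect_cong) (metis in_lists_conv_set lists_eq_set mem_Collect_eq tree_level_eq_length tree_verts_def)

section \<open>Averaging over the geodesics of a finite ball\<close>

text \<open>A leaf \<open>w\<close> of the ball of radius \<open>n\<close> stands for the geodesic from the root to \<open>w\<close>,
  whose vertices are the words \<open>take j w\<close> with \<open>j \<le> n\<close>.\<close>

definition leaves :: "nat \<Rightarrow> nat \<Rightarrow> nat list set" where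
  "leaves q n = {w. set w \<subseteq> {..<q} \<and> length w = n}"

lemma finite_leaves: "finite (leaves q n)"
  unfolding leaves_def by (rule finite_lists_length_eq) simp

lemma finite_tree_ball: "finite (tree_ball q n)"
  unfolding tree_ball_eq by (rule finite_lists_length_le) simp

lemma card_leaves_above:
  assumes "u \<in> tree_ball q n"
  shows "card {w \<in> leaves q n. prefix u w} = q ^ (n - length u)"
proof -
  have "{w \<in> leaves q n. prefix u w} = (\<lambda>s. u @ s) ` leaves q (n - length u)"
    using assms by (auto simp: leaves_def tree_ball_eq prefix_def)
  then have "card {w \<in> leaves q n. prefix u w} = card (leaves q (n - length u))"
    by (simp add: card_image inj_on_def)
  also have "\<dots> = q ^ (n - length u)"
    using card_lists_length_eq[of "{..<q}" "n - length u"] by (simp add: leaves_def)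
  finally show ?thesis .
qed

text \<open>The vertices on the geodesic to \<open>w\<close> are determined by their level, so a sum over levels
  is a sum over the vertices of the ball that lie on the geodesic.\<close>

lemma sum_ancestors:
  fixes F :: "nat list \<Rightarrow> 'a::comm_monoid_add"
  assumes "w \<in> leaves q n"
  shows "(\<Sum>j\<le>n. F (take j w)) = (\<Sum>u\<in>tree_ball q n. if prefix u w then F u else 0)"
proof -
  have "(\<Sum>j\<le>n. F (take j w)) = (\<Sum>u\<in>{u \<in> tree_ball q n. prefix u w}. F u)"
  proof (rule sum.reindex_bij_witness[of _ length "\<lambda>j. take j w"])
    show "take (length u) w = u" if "u \<in> {u \<in> tree_ball q n. prefix u w}" for u
      using that by (auto simp: prefix_def)
    show "take j w \<in> {u \<in> tree_ball q n. prefix u w}" if "j \<in> {..n}" for j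
      using that assms by (auto simp: leaves_def tree_ball_eq take_is_prefix dest: in_set_takeD)
  qed (use assms in \<open>auto simp: leaves_def tree_ball_eq\<close>)
  then show ?thesis
    by (simp add: sum.If_cases finite_tree_ball Int_def)
qed

lemma sum_leaves_ancestors:
  fixes F :: "nat list \<Rightarrow> 'a::{comm_semiring_1}"
  shows "(\<Sum>w\<in>leaves q n. \<Sum>j\<le>n. F (take j w)) = (\<Sum>u\<in>tree_ball q n. of_nat (q ^ (n - length u)) * F u)"
proof -
  have "(\<Sum>w\<in>leaves q n. \<Sum>j\<le>n. F (take j w))
      = (\<Sum>w\<in>leaves q n. \<Sum>u\<in>tree_ball q n. if prefix u w then F u else 0)"
    by (intro sum.cong sum_ancestors) auto
  also have "\<dots> = (\<Sum>u\<in>tree_ball q n. \<Sum>w\<in>leaves q n. if prefix u w then F u else 0)"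
    by (rule sum.swap)
  also have "\<dots> = (\<Sum>u\<in>tree_ball q n. of_nat (card {w \<in> leaves q n. prefix u w}) * F u)"
    by (simp add: sum.If_cases finite_leaves Int_def)
  also have "\<dots> = (\<Sum>u\<in>tree_ball q n. of_nat (q ^ (n - length u)) * F u)"
    by (intro sum.cong) (simp_all add: card_leaves_above)
  finally show ?thesis .
qed

text \<open>The key identity. Two vertices lie on a common geodesic only if they are comparable, and
  then exactly \<open>q ^ (n - max \<bar>u\<bar> \<bar>v\<bar>)\<close> of the \<open>q ^ n\<close> geodesics pass through both.
  Since \<open>d(u,v) = 2 max \<bar>u\<bar> \<bar>v\<bar> - \<bar>u\<bar> - \<bar>v\<bar>\<close> for comparable \<open>u\<close>, \<open>v\<close>, weighting each
  vertex \<open>u\<close> by \<open>q ^ (\<bar>u\<bar>/2)\<close> turns this count into the factor \<open>q ^ (- d(u,v)/2)\<close> of the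
  kernel, including its vanishing on incomparable pairs.\<close>

lemma card_leaves_above_pair:
  assumes "q \<ge> 1" "u \<in> tree_ball q n" "v \<in> tree_ball q n"
  shows "real (card {w \<in> leaves q n. prefix u w \<and> prefix v w}) * sqrt (real q) ^ (length u + length v)
     = real q ^ n * (real q powr (- real (tree_dist q u v) / 2) * indicator (comparable_pairs q) (u, v))"
proof -
  have main: "real (card {w \<in> leaves q n. prefix u w \<and> prefix v w}) * sqrt (real q) ^ (length u + length v)
     = real q ^ n * (real q powr (- real (tree_dist q u v) / 2))"
    if uv: "prefix u v" "v \<in> tree_ball q n" for u v
  proof -
    have "{w \<in> leaves q n. prefix u w \<and> prefix v w} = {w \<in> leaves q n. prefix v w}"
      using uv(1) prefix_order.trans by blast
    then have card: "card {w \<in> leaves q n. prefix u w \<and> prefix v w} = q ^ (n - length v)"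
      using card_leaves_above[OF uv(2)] by simp
    have len: "length u \<le> length v" "length v \<le> n"
      using uv by (auto simp: prefix_length_le tree_ball_eq)
    have d: "tree_dist q u v = length v - length u"
      using uv by (intro tree_dist_prefix) (auto simp: tree_ball_def)
    have q: "real q > 0" using assms(1) by simp
    \<comment> \<open>All powers become real powers of \<open>q\<close>, so that only exponents have to be compared.\<close>
    have "sqrt (real q) ^ (length u + length v) = real q powr (real (length u + length v) / 2)"
      using q by (simp add: powr_half_sqrt[symmetric] powr_realpow[symmetric] powr_powr)
    moreover have "real q ^ (n - length v) = real q powr (real n - real (length v))"
         "real q ^ n = real q powr real n"
      using q len by (simp_all add: powr_realpow[symmetric] of_nat_diff)
    ultimately show ?thesis
      unfolding card d using len by (simp add: powr_add[symmetric] of_nat_diff field_simps)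
  qed
  have V: "u \<in> tree_verts q" "v \<in> tree_verts q" using assms by (auto simp: tree_ball_def)
  consider "prefix u v" | "prefix v u" | "\<not> prefix u v" "\<not> prefix v u" by blast
  then show ?thesis
  proof cases
    case 1
    then show ?thesis
      using main[OF 1 assms(3)] comparable_pairs_iff_prefix[OF assms(1) V] by simp
  next
    case 2
    then show ?thesis
      using main[OF 2 assms(2)] comparable_pairs_iff_prefix[OF assms(1) V]
      by (simp add: tree_dist_sym[of q v u] add.commute conj_commute)
  next
    case 3
    then have no_common: "{w \<in> leaves q n. prefix u w \<and> prefix v w} = {}"
      using prefix_same_cases by blast
    show ?thesis
      unfolding no_common using 3 comparable_pairs_iff_prefix[OF assms(1) V] by simp
  qed
qed

section \<open>Toeplitz forms of bounded symbols\<close>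

lemma prob_space_angle_measure: "prob_space angle_measure"
  unfolding angle_measure_def by (rule prob_space_uniform_measure) auto

lemma sets_angle_measure [measurable_cong]: "sets angle_measure = sets borel"
  by (simp add: angle_measure_def)

lemma cis_measurable_circle:
  "cis \<in> measurable angle_measure (restrict_space borel (sphere 0 1))"
  by (intro measurable_restrict_space2)
    (auto simp: measurable_cong_sets[OF sets_angle_measure refl]
       intro!: borel_measurable_continuous_onI continuous_intros)

text \<open>The half-open period is closed up, which changes a null set only, so that the fundamental
  theorem of calculus on a compact interval applies.\<close>

lemma integral_angle_measure:
  fixes h :: "real \<Rightarrow> 'a::euclidean_space"
  assumes [measurable]: "h \<in> borel_measurable borel"
  shows "(LINT t|angle_measure. h t)
      = (1 / (2 * pi)) *\<^sub>R (LINT t|lborel. indicator {0..2 * pi} t *\<^sub>R h t)"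
proof -
  have density: "angle_measure = density lborel (\<lambda>t. ennreal (indicator {0..<2 * pi} t / (2 * pi)))"
    unfolding angle_measure_def uniform_measure_def
    by (intro arg_cong[where f = "density lborel"] ext)
      (auto simp: indicator_def divide_ennreal ennreal_1[symmetric] simp del: ennreal_1)
  have "(LINT t|angle_measure. h t)
      = (LINT t|lborel. (indicator {0..<2 * pi} t / (2 * pi)) *\<^sub>R h t)"
    unfolding density by (rule integral_density) auto
  also have "\<dots> = (LINT t|lborel. (1 / (2 * pi)) *\<^sub>R (indicator {0..2 * pi} t *\<^sub>R h t))"
  proof (rule integral_cong_AE)
    show "AE t in lborel. (indicator {0..<2 * pi} t / (2 * pi)) *\<^sub>R h t
        = (1 / (2 * pi)) *\<^sub>R (indicator {0..2 * pi} t *\<^sub>R h t)"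
      using AE_lborel_singleton[of "2 * pi"] by eventually_elim (auto simp: indicator_def)
  qed measurable
  finally show ?thesis by (simp only: integral_scaleR_right)
qed

lemma cis_orthonormal:
  "(LINT t|angle_measure. cis (real_of_int m * t)) = (if m = 0 then 1 else 0)"
proof (cases "m = 0")
  case True
  then show ?thesis
    using prob_space.prob_space[OF prob_space_angle_measure] by simp
next
  case False
  have "(LINT t|lborel. indicator {0..2 * pi} t *\<^sub>R cis (real_of_int m * t))
     = (- \<i> / of_int m) * cis (real_of_int m * (2 * pi)) - (- \<i> / of_int m) * cis (real_of_int m * 0)"
  proof (rule integral_FTC_atLeastAtMost)
    show "((\<lambda>t. (- \<i> / of_int m) * cis (real_of_int m * t)) has_vector_derivative
        cis (real_of_int m * x)) (at x within {0..2 * pi})" for x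
    proof -
      have "((\<lambda>z. (- \<i> / of_int m) * exp (\<i> * (of_int m * z))) has_field_derivative
          exp (\<i> * (of_int m * of_real x))) (at (of_real x))"
        using False by (auto intro!: derivative_eq_intros simp: field_simps)
      from has_vector_derivative_real_field[OF this] show ?thesis
        by (simp add: cis_conv_exp)
    qed
  qed (auto intro!: continuous_intros)
  also have "cis (real_of_int m * (2 * pi)) = 1"
    using cis_multiple_2pi[of "real_of_int m"] by (simp add: mult_ac)
  finally show ?thesis
    using False
    by (subst integral_angle_measure) (auto intro!: borel_measurable_continuous_onI continuous_intros)
qed

lemma angle_measure_integrable_bounded:
  fixes h :: "real \<Rightarrow> 'a::{banach, second_countable_topology}"
  assumes "h \<in> borel_measurable angle_measure" "AE t in angle_measure. norm (h t) \<le> M"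
  shows "integrable angle_measure h"
proof -
  interpret prob_space angle_measure by (rule prob_space_angle_measure)
  show ?thesis by (rule integrable_const_bound[OF assms(2,1)])
qed

lemma cis_measurable [measurable]:
  "(\<lambda>t. cis (c * t)) \<in> borel_measurable angle_measure"
  unfolding measurable_cong_sets[OF sets_angle_measure refl]
  by (intro borel_measurable_continuous_onI continuous_intros)

lemma integrable_cis: "integrable angle_measure (\<lambda>t. cis (c * t))"
  by (rule angle_measure_integrable_bounded[where M = 1]) auto

definition trig_poly :: "nat \<Rightarrow> (nat \<Rightarrow> complex) \<Rightarrow> real \<Rightarrow> complex" where
  "trig_poly n a t = (\<Sum>j\<le>n. a j * cis (real j * t))"

lemma trig_poly_measurable [measurable]: "trig_poly n a \<in> borel_measurable angle_measure"
  unfolding trig_poly_def by measurable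

lemma cnj_trig_poly_mult:
  "cnj (trig_poly n a t) * trig_poly n b t
    = (\<Sum>j\<le>n. \<Sum>k\<le>n. cnj (a j) * b k * cis (- (real_of_int (int j - int k) * t)))"
  unfolding trig_poly_def cnj_sum sum_product
  by (intro sum.cong refl) (simp add: cis_cnj cis_mult algebra_simps)

lemma cmod_trig_poly_le: "cmod (trig_poly n a t) \<le> (\<Sum>j\<le>n. cmod (a j))"
  unfolding trig_poly_def by (rule sum_norm_le) (simp add: norm_mult)

lemma integrable_trig_poly_square:
  "integrable angle_measure (\<lambda>t. (cmod (trig_poly n a t))\<^sup>2)"
  by (rule angle_measure_integrable_bounded[where M = "(\<Sum>j\<le>n. cmod (a j))\<^sup>2"])
    (auto intro!: power_mono cmod_trig_poly_le)

lemma trig_poly_parseval: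
  "(LINT t|angle_measure. (cmod (trig_poly n a t))\<^sup>2) = (\<Sum>j\<le>n. (cmod (a j))\<^sup>2)"
proof -
  have coeff: "(LINT t|angle_measure. cnj (a j) * a k * cis (- (real_of_int (int j - int k) * t)))
      = (if k = j then of_real ((cmod (a j))\<^sup>2) else 0)" for j k
    using cis_orthonormal[of "int k - int j"] complex_norm_square[of "a j"]
    by (auto simp: algebra_simps)
  have int: "integrable angle_measure (\<lambda>t. cis (- (real_of_int (int j - int k) * t)))" for j k
    using integrable_cis[of "- real_of_int (int j - int k)"] by (simp only: mult_minus_left)
  have square: "cnj z * z = complex_of_real ((cmod z)\<^sup>2)" for z
    by (simp only: complex_norm_square mult.commute)
  have "complex_of_real (LINT t|angle_measure. (cmod (trig_poly n a t))\<^sup>2)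
      = (LINT t|angle_measure. cnj (trig_poly n a t) * trig_poly n a t)"
    by (simp only: square integral_complex_of_real)
  also have "\<dots> = (\<Sum>j\<le>n. \<Sum>k\<le>n.
      (LINT t|angle_measure. cnj (a j) * a k * cis (- (real_of_int (int j - int k) * t))))"
    unfolding cnj_trig_poly_mult using int
    by (subst Bochner_Integration.integral_sum,
        force intro!: Bochner_Integration.integrable_sum integrable_mult_right)
      (intro sum.cong refl Bochner_Integration.integral_sum integrable_mult_right)
  also have "\<dots> = complex_of_real (\<Sum>j\<le>n. (cmod (a j))\<^sup>2)"
    unfolding coeff by simp
  finally show ?thesis by (simp only: of_real_eq_iff)
qed

text \<open>The Toeplitz form with entries the Fourier coefficients of \<open>h\<close> is the integral of
  \<open>h \<cdot> cnj A \<cdot> B\<close>, where \<open>A\<close> and \<open>B\<close> are the trigonometric polynomials with coefficients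
  \<open>a\<close> and \<open>b\<close>. The integrand is at most \<open>M (\<bar>A\<bar>\<^sup>2 + \<bar>B\<bar>\<^sup>2) / 2\<close>, and Parseval evaluates the
  integral of that. Using the arithmetic mean here instead of the Cauchy-Schwarz inequality
  gives a bound that is additive over families of vectors.\<close>

lemma toeplitz_form_bound:
  fixes h :: "real \<Rightarrow> complex"
  assumes h [measurable]: "h \<in> borel_measurable angle_measure"
    and bound: "AE t in angle_measure. cmod (h t) \<le> M"
    and f: "\<And>j k. j \<le> n \<Longrightarrow> k \<le> n \<Longrightarrow>
      f (int j - int k) = (LINT t|angle_measure. h t * cis (- (real_of_int (int j - int k) * t)))"
  shows "cmod (\<Sum>j\<le>n. \<Sum>k\<le>n. cnj (a j) * f (int j - int k) * b k)
    \<le> M * ((\<Sum>j\<le>n. (cmod (a j))\<^sup>2) + (\<Sum>j\<le>n. (cmod (b j))\<^sup>2)) / 2"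
proof -
  let ?A = "trig_poly n a" and ?B = "trig_poly n b"
  have meas: "(\<lambda>t. cis (- (real_of_int m * t))) \<in> borel_measurable angle_measure" for m
    using cis_measurable[of "- real_of_int m"] by simp
  have int: "integrable angle_measure
      (\<lambda>t. cnj (a j) * b k * (h t * cis (- (real_of_int (int j - int k) * t))))" for j k
    using bound
    by (intro integrable_mult_right angle_measure_integrable_bounded[where M = M]
        borel_measurable_times h meas) (simp add: norm_mult)
  have "(\<Sum>j\<le>n. \<Sum>k\<le>n. cnj (a j) * f (int j - int k) * b k)
      = (\<Sum>j\<le>n. \<Sum>k\<le>n. (LINT t|angle_measure.
          cnj (a j) * b k * (h t * cis (- (real_of_int (int j - int k) * t)))))"
    by (intro sum.cong refl) (simp add: f)
  also have "\<dots> = (LINT t|angle_measure. (\<Sum>j\<le>n. \<Sum>k\<le>n.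
          cnj (a j) * b k * (h t * cis (- (real_of_int (int j - int k) * t)))))"
    using int
    by (subst Bochner_Integration.integral_sum,
        force intro!: Bochner_Integration.integrable_sum)
      (intro sum.cong refl Bochner_Integration.integral_sum[symmetric])
  also have "\<dots> = (LINT t|angle_measure. h t * (cnj (?A t) * ?B t))"
    unfolding cnj_trig_poly_mult sum_distrib_left
    by (intro Bochner_Integration.integral_cong sum.cong refl) (simp add: mult_ac)
  finally have "cmod (\<Sum>j\<le>n. \<Sum>k\<le>n. cnj (a j) * f (int j - int k) * b k)
      \<le> (LINT t|angle_measure. cmod (h t * (cnj (?A t) * ?B t)))"
    by simp
  also have "\<dots> \<le> (LINT t|angle_measure. M / 2 * ((cmod (?A t))\<^sup>2 + (cmod (?B t))\<^sup>2))"
  proof (rule integral_mono_AE')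
    show "integrable angle_measure (\<lambda>t. M / 2 * ((cmod (?A t))\<^sup>2 + (cmod (?B t))\<^sup>2))"
      by (intro integrable_mult_right Bochner_Integration.integrable_add integrable_trig_poly_square)
    show "AE t in angle_measure. cmod (h t * (cnj (?A t) * ?B t))
        \<le> M / 2 * ((cmod (?A t))\<^sup>2 + (cmod (?B t))\<^sup>2)"
      using bound
    proof eventually_elim
      case (elim t)
      have amgm: "cmod (?A t) * cmod (?B t) \<le> ((cmod (?A t))\<^sup>2 + (cmod (?B t))\<^sup>2) / 2"
        using sum_squares_bound[of "cmod (?A t)" "cmod (?B t)"] by simp
      have "cmod (h t) * (cmod (?A t) * cmod (?B t))
          \<le> M * (((cmod (?A t))\<^sup>2 + (cmod (?B t))\<^sup>2) / 2)"
        using elim order_trans[OF norm_ge_zero elim] by (intro mult_mono amgm) auto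
      then show ?case by (simp add: norm_mult)
    qed
    show "AE t in angle_measure. 0 \<le> M / 2 * ((cmod (?A t))\<^sup>2 + (cmod (?B t))\<^sup>2)"
      using bound
    proof eventually_elim
      case (elim t)
      then show ?case using order_trans[OF norm_ge_zero elim] by simp
    qed
  qed
  also have "\<dots> = M / 2 * ((\<Sum>j\<le>n. (cmod (a j))\<^sup>2) + (\<Sum>j\<le>n. (cmod (b j))\<^sup>2))"
    by (simp add: integrable_trig_poly_square trig_poly_parseval)
  finally show ?thesis by simp
qed

section \<open>The norm of the tree matrix\<close>

text \<open>The hypothesis for \<open>x\<close> in the unit ball and the unit vector \<open>y = A x / \<parallel>A x\<parallel>\<close> gives
  \<open>\<parallel>A x\<parallel> \<le> M\<close>.\<close>

lemma matrix_onorm_le: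
  assumes "finite B" "M \<ge> 0"
    and form: "\<And>x y. cmod (\<Sum>u\<in>B. \<Sum>v\<in>B. cnj (y u) * A u v * x v)
      \<le> M * ((\<Sum>u\<in>B. (cmod (y u))\<^sup>2) + (\<Sum>v\<in>B. (cmod (x v))\<^sup>2)) / 2"
  shows "matrix_onorm B A \<le> M"
  unfolding matrix_onorm_def
proof (rule cSUP_least)
  have "(\<lambda>_. 0) \<in> {x. L2_set (\<lambda>v. cmod (x v)) B \<le> 1}" by (simp add: L2_set_def)
  then show "{x. L2_set (\<lambda>v. cmod (x v)) B \<le> 1} \<noteq> {}" by (intro notI) (simp only: empty_iff)
next
  fix x :: "'a \<Rightarrow> complex"
  assume "x \<in> {x. L2_set (\<lambda>v. cmod (x v)) B \<le> 1}"
  then have x: "(\<Sum>v\<in>B. (cmod (x v))\<^sup>2) \<le> 1" by (simp add: L2_set_def)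
  define z where "z u = (\<Sum>v\<in>B. A u v * x v)" for u
  define r where "r = L2_set (\<lambda>u. cmod (z u)) B"
  have r2: "r\<^sup>2 = (\<Sum>u\<in>B. (cmod (z u))\<^sup>2)"
    by (simp add: r_def L2_set_def sum_nonneg)
  show "L2_set (\<lambda>u. cmod (\<Sum>v\<in>B. A u v * x v)) B \<le> M"
  proof (cases "r = 0")
    case True
    then show ?thesis using assms(2) by (simp add: r_def z_def)
  next
    case False
    then have "r > 0" using L2_set_nonneg by (simp add: r_def order_less_le)
    define y where "y u = z u / of_real r" for u
    have "(\<Sum>u\<in>B. \<Sum>v\<in>B. cnj (y u) * A u v * x v) = (\<Sum>u\<in>B. cnj (y u) * z u)"
      by (simp add: z_def sum_distrib_left mult.assoc)
    also have "\<dots> = (\<Sum>u\<in>B. of_real ((cmod (z u))\<^sup>2 / r))"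
      by (intro sum.cong refl) (simp only: y_def complex_cnj_divide complex_cnj_complex_of_real
          of_real_divide complex_norm_square times_divide_eq_right mult.commute)
    also have "\<dots> = of_real r"
      unfolding of_real_sum[symmetric] sum_divide_distrib[symmetric] r2[symmetric]
      using \<open>r > 0\<close> by (simp add: power2_eq_square)
    finally have "cmod (\<Sum>u\<in>B. \<Sum>v\<in>B. cnj (y u) * A u v * x v) = r"
      using \<open>r > 0\<close> by simp
    moreover have "(\<Sum>u\<in>B. (cmod (y u))\<^sup>2) = 1"
      unfolding y_def norm_divide power_divide sum_divide_distrib[symmetric] r2[symmetric]
      using \<open>r > 0\<close> by simp
    ultimately have "r \<le> M * (1 + (\<Sum>v\<in>B. (cmod (x v))\<^sup>2)) / 2"
      using form[of y x] by simp
    also have "\<dots> \<le> M * (1 + 1) / 2"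
      using x assms(2) by (intro divide_right_mono mult_left_mono add_left_mono) auto
    finally show ?thesis by (simp add: r_def z_def)
  qed
qed

text \<open>The tree form is the average, over all geodesics of length \<open>n\<close>, of one and the same
  \<open>(n+1) \<times> (n+1)\<close> Toeplitz form, evaluated at the restrictions of \<open>y\<close> and \<open>x\<close> to the geodesic
  with the entry at level \<open>j\<close> scaled by \<open>q ^ (j/2)\<close>.\<close>

lemma Gamma_form_average:
  assumes "q \<ge> 1"
  shows "of_nat (q ^ n) * (\<Sum>u\<in>tree_ball q n. \<Sum>v\<in>tree_ball q n. cnj (y u) * Gamma_kernel q f u v * x v)
    = (\<Sum>w\<in>leaves q n. \<Sum>j\<le>n. \<Sum>k\<le>n.
        cnj (of_real (sqrt (real q) ^ j) * y (take j w)) * f (int j - int k)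
          * (of_real (sqrt (real q) ^ k) * x (take k w)))"
proof -
  let ?B = "tree_ball q n"
  define G where "G u v = cnj (of_real (sqrt (real q) ^ length u) * y u) * f (int (length u) - int (length v))
      * (of_real (sqrt (real q) ^ length v) * x v)" for u v
  have "(\<Sum>w\<in>leaves q n. \<Sum>j\<le>n. \<Sum>k\<le>n.
        cnj (of_real (sqrt (real q) ^ j) * y (take j w)) * f (int j - int k)
          * (of_real (sqrt (real q) ^ k) * x (take k w)))
      = (\<Sum>w\<in>leaves q n. \<Sum>j\<le>n. \<Sum>k\<le>n. G (take j w) (take k w))"
    by (intro sum.cong refl) (simp add: G_def leaves_def)
  also have "\<dots> = (\<Sum>w\<in>leaves q n. \<Sum>u\<in>?B. \<Sum>v\<in>?B. if prefix u w \<and> prefix v w then G u v else 0)"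
  proof (rule sum.cong[OF refl])
    fix w assume w: "w \<in> leaves q n"
    have "(\<Sum>j\<le>n. \<Sum>k\<le>n. G (take j w) (take k w))
        = (\<Sum>u\<in>?B. if prefix u w then \<Sum>v\<in>?B. if prefix v w then G u v else 0 else 0)"
      unfolding sum_ancestors[OF w] by (rule sum_ancestors[OF w])
    also have "\<dots> = (\<Sum>u\<in>?B. \<Sum>v\<in>?B. if prefix u w \<and> prefix v w then G u v else 0)"
      by (intro sum.cong refl) simp
    finally show "(\<Sum>j\<le>n. \<Sum>k\<le>n. G (take j w) (take k w))
        = (\<Sum>u\<in>?B. \<Sum>v\<in>?B. if prefix u w \<and> prefix v w then G u v else 0)" .
  qed
  also have "\<dots> = (\<Sum>u\<in>?B. \<Sum>w\<in>leaves q n. \<Sum>v\<in>?B. if prefix u w \<and> prefix v w then G u v else 0)"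
    by (rule sum.swap)
  also have "\<dots> = (\<Sum>u\<in>?B. \<Sum>v\<in>?B. \<Sum>w\<in>leaves q n. if prefix u w \<and> prefix v w then G u v else 0)"
    by (rule sum.cong[OF refl]) (rule sum.swap)
  also have "\<dots> = (\<Sum>u\<in>?B. \<Sum>v\<in>?B. of_nat (card {w \<in> leaves q n. prefix u w \<and> prefix v w}) * G u v)"
    by (simp add: sum.If_cases finite_leaves Int_def)
  also have "\<dots> = (\<Sum>u\<in>?B. \<Sum>v\<in>?B. of_nat (q ^ n) * (cnj (y u) * Gamma_kernel q f u v * x v))"
  proof (intro sum.cong refl)
    fix u v assume uv: "u \<in> ?B" "v \<in> ?B"
    then have lev: "tree_level q u = length u" "tree_level q v = length v"
      by (auto simp: tree_ball_def tree_level_eq_length)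
    have "of_nat (card {w \<in> leaves q n. prefix u w \<and> prefix v w}) * G u v
      = complex_of_real (real (card {w \<in> leaves q n. prefix u w \<and> prefix v w}) * sqrt (real q) ^ (length u + length v))
        * (cnj (y u) * f (int (length u) - int (length v)) * x v)"
      by (simp add: G_def power_add mult_ac)
    also have "\<dots> = of_nat (q ^ n) * (cnj (y u) * Gamma_kernel q f u v * x v)"
      unfolding card_leaves_above_pair[OF assms uv]
      by (simp add: Gamma_kernel_def lev mult_ac indicator_def)
    finally show "of_nat (card {w \<in> leaves q n. prefix u w \<and> prefix v w}) * G u v
      = of_nat (q ^ n) * (cnj (y u) * Gamma_kernel q f u v * x v)" .
  qed
  finally show ?thesis by (simp add: sum_distrib_left)
qed

text \<open>The scaled restrictions preserve the Euclidean norm on average: a vertex at level \<open>j\<close> lies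
  on a fraction \<open>q ^ (- j)\<close> of the geodesics and carries the weight \<open>q ^ j\<close>.\<close>

lemma leaf_rows_isometry:
  "(\<Sum>w\<in>leaves q n. \<Sum>j\<le>n. (cmod (of_real (sqrt (real q) ^ j) * x (take j w)))\<^sup>2)
    = real q ^ n * (\<Sum>u\<in>tree_ball q n. (cmod (x u))\<^sup>2)"
proof -
  have "(\<Sum>w\<in>leaves q n. \<Sum>j\<le>n. (cmod (of_real (sqrt (real q) ^ j) * x (take j w)))\<^sup>2)
      = (\<Sum>w\<in>leaves q n. \<Sum>j\<le>n. real q ^ length (take j w) * (cmod (x (take j w)))\<^sup>2)"
  proof (intro sum.cong refl)
    fix w j assume "w \<in> leaves q n" "j \<in> {..n}"
    moreover have "(sqrt (real q) ^ j)\<^sup>2 = real q ^ j"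
      by (simp add: power_mult[symmetric] mult.commute[of j]) (simp add: power_mult)
    ultimately show "(cmod (of_real (sqrt (real q) ^ j) * x (take j w)))\<^sup>2
        = real q ^ length (take j w) * (cmod (x (take j w)))\<^sup>2"
      by (simp add: leaves_def norm_mult norm_power power_mult_distrib)
  qed
  also have "\<dots> = (\<Sum>u\<in>tree_ball q n. real (q ^ (n - length u)) * (real q ^ length u * (cmod (x u))\<^sup>2))"
    by (rule sum_leaves_ancestors)
  also have "\<dots> = (\<Sum>u\<in>tree_ball q n. real q ^ n * (cmod (x u))\<^sup>2)"
  proof (intro sum.cong refl)
    fix u assume "u \<in> tree_ball q n"
    then have "real q ^ (n - length u) * real q ^ length u = real q ^ n"
      by (simp add: tree_ball_eq flip: power_add)
    then show "real (q ^ (n - length u)) * (real q ^ length u * (cmod (x u))\<^sup>2) = real q ^ n * (cmod (x u))\<^sup>2"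
      by (simp flip: mult.assoc)
  qed
  finally show ?thesis by (simp add: sum_distrib_left)
qed

lemma Gamma_norm_le:
  fixes h :: "real \<Rightarrow> complex"
  assumes q: "q \<ge> 1"
    and h: "h \<in> borel_measurable angle_measure"
    and bound: "AE t in angle_measure. cmod (h t) \<le> M"
    and f: "\<And>k. - int n \<le> k \<Longrightarrow> k \<le> int n \<Longrightarrow>
      f k = (LINT t|angle_measure. h t * cis (- (real_of_int k * t)))"
  shows "Gamma_norm q n f \<le> M"
  unfolding Gamma_norm_def
proof (rule matrix_onorm_le[OF finite_tree_ball])
  interpret prob_space angle_measure by (rule prob_space_angle_measure)
  have "AE t in angle_measure. 0 \<le> M"
    using bound by eventually_elim (rule order_trans[OF norm_ge_zero])
  then show "M \<ge> 0" by simp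
next
  fix x y :: "nat list \<Rightarrow> complex"
  let ?s = "\<lambda>j. complex_of_real (sqrt (real q) ^ j)"
  let ?S = "\<Sum>u\<in>tree_ball q n. \<Sum>v\<in>tree_ball q n. cnj (y u) * Gamma_kernel q f u v * x v"
  let ?N = "\<lambda>x. \<Sum>u\<in>tree_ball q n. (cmod (x u))\<^sup>2"
  have "real q ^ n * cmod ?S = cmod (of_nat (q ^ n) * ?S)"
    by (simp add: norm_mult norm_power)
  also have "\<dots> \<le> (\<Sum>w\<in>leaves q n. M * ((\<Sum>j\<le>n. (cmod (?s j * y (take j w)))\<^sup>2)
      + (\<Sum>j\<le>n. (cmod (?s j * x (take j w)))\<^sup>2)) / 2)"
    unfolding Gamma_form_average[OF q]
    by (intro sum_norm_le toeplitz_form_bound[OF h bound] f) auto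
  also have "\<dots> = M * ((\<Sum>w\<in>leaves q n. \<Sum>j\<le>n. (cmod (?s j * y (take j w)))\<^sup>2)
      + (\<Sum>w\<in>leaves q n. \<Sum>j\<le>n. (cmod (?s j * x (take j w)))\<^sup>2)) / 2"
    by (simp only: sum.distrib sum_distrib_left[symmetric] sum_divide_distrib[symmetric])
  also have "\<dots> = real q ^ n * (M * (?N y + ?N x) / 2)"
    unfolding leaf_rows_isometry by (simp add: algebra_simps)
  finally show "cmod ?S \<le> M * (?N y + ?N x) / 2"
    using q by (simp add: mult_le_cancel_left_pos)
qed

lemma Linf_circle_pullback:
  assumes "g \<in> Linf_circle" "Linf_norm g \<le> ereal M"
  shows "(\<lambda>t. g (cis t)) \<in> borel_measurable angle_measure"
    and "AE t in angle_measure. cmod (g (cis t)) \<le> M"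
proof -
  have "g \<in> borel_measurable (restrict_space borel (sphere 0 1))"
    using assms(1) by (simp add: Linf_circle_def circle_measure_def)
  then show "(\<lambda>t. g (cis t)) \<in> borel_measurable angle_measure"
    by (rule measurable_compose[OF cis_measurable_circle])
  have "AE z in circle_measure. cmod (g z) \<le> M"
    using esssup_AE[of "\<lambda>z. ereal (cmod (g z))" circle_measure]
  proof eventually_elim
    case (elim z)
    then show ?case
      using order_trans[OF elim assms(2)[unfolded Linf_norm_def]] by simp
  qed
  then show "AE t in angle_measure. cmod (g (cis t)) \<le> M"
    unfolding circle_measure_def by (rule AE_distrD[OF cis_measurable_circle])
qed

theorem proposition1p19:
  fixes n :: nat and f :: "int \<Rightarrow> complex"
  assumes "n \<ge> 1"
  shows "c_const n f \<ge> (SUP q \<in> {q::nat. q \<ge> 2}. ereal (Gamma_norm q n f))"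
  unfolding c_const_def
proof (intro SUP_least INF_greatest)
  fix q g
  assume q: "q \<in> {q::nat. q \<ge> 2}"
    and g: "g \<in> {g \<in> Linf_circle. \<forall>k. - int n \<le> k \<and> k \<le> int n \<longrightarrow> fourier_coeff g k = f k}"
  \<comment> \<open>Comparing with real upper bounds of the essential supremum covers all its extended real
    values at once; only \<open>\<infinity>\<close> has none.\<close>
  have "ereal (Gamma_norm q n f) \<le> ereal M" if M: "Linf_norm g \<le> ereal M" for M
  proof -
    have "g \<in> Linf_circle" using g by simp
    note pullback = Linf_circle_pullback[OF this M]
    have "Gamma_norm q n f \<le> M"
    proof (rule Gamma_norm_le[OF _ pullback])
      show "q \<ge> 1" using q by simp
      show "f k = (LINT t|angle_measure. g (cis t) * cis (- (real_of_int k * t)))"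
        if "- int n \<le> k" "k \<le> int n" for k
        using g that by (auto simp: fourier_coeff_def)
    qed
    then show ?thesis by simp
  qed
  then show "ereal (Gamma_norm q n f) \<le> Linf_norm g"
    by (rule ereal_le_real)
qed

end
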